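(* Let $D(x)\in\mathbb{Q}[x]$ be monic, squarefree, of degree $2g+2$, and let $\mathcal{C}: y^2=D(x)$. Suppose the class of the divisor at infinity of $\mathcal{C}$ is torsion of order $m>1$ on the Jacobian of $\mathcal{C}$; equivalently, the domain $\mathbb{Q}[x,y]$ contains nontrivial units and its fundamental unit $u=a+by$ (with $a,b\in\mathbb{Q}[x]$) has degree $\deg a=m$. Let $k=a^2-Db^2\in\mathbb{Q}\setminus\{0\}$ be the norm of $u$. Denote the continued fraction expansion of $y$ by $y=[A,a_1,a_2,a_3,\dots]$. Then: (a) If $[A,a_1,a_2,\dots,a_{r-1}]=a/b$ with $r$ even, then $k=1$, where $u$ is scaled so that $a$ and $b$ are the continuants giving the numerator and denominator of this convergent. (b) If $k=c^2$ is a square in $\mathbb{Q}$, then the polynomial $b$ factorises over $\mathbb{Q}$ as $b=d_+d_-$, in such a way that $D$ is reducible over $\mathbb{Q}$ because it is the product of the nontrivial (that is, nonconstant) polynomials $(a+c)/d_+^2$ and $(a-c)/d_-^2$ in $\mathbb{Q}[x]$. (c) If $k=c^2$ is not a square in $\mathbb{Q}$, and $u$ is scaled (and replaced by its conjugate if necessary) so that $a$ and $b$ are monic, then the polynomial $b$ factorises over $\mathbb{Q}(c)$ as a product $b=d\,\overline{d}$ of polynomials conjugate over $\mathbb{Q}(c)$, in such a way that $D$ factorises over $\mathbb{Q}(c)$ as the product of the two polynomials $(a+c)/d^2$ and $(a+\overline{c})/\overline{d}^{\,2}$.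
   Context: The domain $\mathbb{Q}[x,y]$ means $\mathbb{Q}[x][Y]/(Y^2-D(x))$, with elements $a+by$, $a,b\in\mathbb{Q}[x]$. A unit is an element whose norm $a^2-Db^2$ is a nonzero constant; it is nontrivial if it is not in $\mathbb{Q}$. The degree of a unit $a+by$ is $\deg a$. A fundamental unit is a nontrivial unit of minimal degree; it is unique up to multiplication by a nonzero constant, inversion and conjugation. The curve $\mathcal{C}$ (smooth projective model) has two points at infinity, $O$ and $S$; the divisor at infinity is $S-O$. Continued fraction: regard $y=\sqrt{D}$ as a Laurent series in $\mathbb{Q}((x^{-1}))$ with leading coefficient $1$. Its continued fraction expansion $[A,a_1,a_2,\dots]$ is obtained by repeatedly taking the polynomial part as partial quotient and inverting the remainder; $A$, of degree $g+1$, is the polynomial part of $y$. The continuants of $[A,a_1,\dots,a_{r-1}]$ are $p_{r-1},q_{r-1}$, where $p_{-1}=1,\ p_0=A,\ q_{-1}=0,\ q_0=1$, and $p_h=a_hp_{h-1}+p_{h-2}$, $q_h=a_hq_{h-1}+q_{h-2}$; thus $[A,a_1,\dots,a_{r-1}]=p_{r-1}/q_{r-1}$. The overline denotes conjugation by the nontrivial automorphism of the quadratic extension $\mathbb{Q}(c)/\mathbb{Q}$, applied to coefficients of polynomials. *)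

theory Defs
  imports "HOL-Computational_Algebra.Computational_Algebra" Complex_Main
begin

unbundle fps_syntax

section \<open>Units of the domain $\mathbb{Q}[x,y]$, $y^2 = D(x)$\<close>

text \<open>An element $a + b y$ of $\mathbb{Q}[x][Y]/(Y^2 - D)$ is given by its components \<open>a\<close> and \<open>b\<close>.\<close>

definition qnorm :: "rat poly \<Rightarrow> rat poly \<Rightarrow> rat poly \<Rightarrow> rat poly" where
  "qnorm D a b = a\<^sup>2 - D * b\<^sup>2"

definition qunit :: "rat poly \<Rightarrow> rat poly \<Rightarrow> rat poly \<Rightarrow> bool" where
  "qunit D a b \<longleftrightarrow> (\<exists>k. k \<noteq> 0 \<and> qnorm D a b = [:k:])"

definition nontrivial_qunit :: "rat poly \<Rightarrow> rat poly \<Rightarrow> rat poly \<Rightarrow> bool" where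
  "nontrivial_qunit D a b \<longleftrightarrow> qunit D a b \<and> \<not> (b = 0 \<and> degree a = 0)"

definition fundamental_qunit :: "rat poly \<Rightarrow> rat poly \<Rightarrow> rat poly \<Rightarrow> bool" where
  "fundamental_qunit D a b \<longleftrightarrow> nontrivial_qunit D a b \<and>
     (\<forall>a' b'. nontrivial_qunit D a' b' \<longrightarrow> degree a \<le> degree a')"


section \<open>Continued fractions of Laurent series in $x^{-1}$\<close>

text \<open>
  The formal variable \<open>fls_X\<close> of type \<open>rat fls\<close> stands for $x^{-1}$, so that $x$ itself is
  \<open>fls_X_inv\<close>, and the coefficient of $x^n$ in \<open>f\<close> is \<open>f $$ (- n)\<close>.
\<close>

definition poly_to_fls :: "rat poly \<Rightarrow> rat fls" where
  "poly_to_fls p = poly (map_poly fls_const p) fls_X_inv"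

text \<open>\<open>fls_prpart\<close> collects the terms with positive powers of $x$ only, without the constant term.\<close>

definition poly_part :: "rat fls \<Rightarrow> rat poly" where
  "poly_part f = fls_prpart f + [:f $$ 0:]"

text \<open>\<open>f $$ fls_subdegree f\<close> is the coefficient of the highest power of $x$ in \<open>f\<close>.\<close>

definition fls_sqrt :: "rat poly \<Rightarrow> rat fls" where
  "fls_sqrt D = (THE y. y\<^sup>2 = poly_to_fls D \<and> y $$ fls_subdegree y = 1)"

primrec complete_quot :: "rat fls \<Rightarrow> nat \<Rightarrow> rat fls" where
  "complete_quot y 0 = y"
| "complete_quot y (Suc n) =
     inverse (complete_quot y n - poly_to_fls (poly_part (complete_quot y n)))"

definition partial_quot :: "rat fls \<Rightarrow> nat \<Rightarrow> rat poly" where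
  "partial_quot y n = poly_part (complete_quot y n)"

text \<open>
  The index is shifted by one: \<open>cf_num y r\<close> is $p_{r-1}$ and \<open>cf_den y r\<close> is $q_{r-1}$, so that
  $[a_0, a_1, \dots, a_{r-1}]$ is \<open>cf_num y r / cf_den y r\<close> for \<open>r > 0\<close>.
\<close>

fun cf_num :: "rat fls \<Rightarrow> nat \<Rightarrow> rat poly" where
  "cf_num y 0 = 1"
| "cf_num y (Suc 0) = partial_quot y 0"
| "cf_num y (Suc (Suc n)) = partial_quot y (Suc n) * cf_num y (Suc n) + cf_num y n"

fun cf_den :: "rat fls \<Rightarrow> nat \<Rightarrow> rat poly" where
  "cf_den y 0 = 0"
| "cf_den y (Suc 0) = 1"
| "cf_den y (Suc (Suc n)) = partial_quot y (Suc n) * cf_den y (Suc n) + cf_den y n"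


section \<open>The quadratic field $\mathbb{Q}(c)$\<close>

definition quad_field :: "complex \<Rightarrow> complex set" where
  "quad_field c = {of_rat r + of_rat s * c | r s. True}"

text \<open>
  This is the nontrivial automorphism of $\mathbb{Q}(c)$ when $c^2$ is rational and $c$ is not; it
  is unrelated to complex conjugation if $c$ is real. Values outside \<open>quad_field c\<close> are
  irrelevant.
\<close>

definition quad_conj :: "complex \<Rightarrow> complex \<Rightarrow> complex" where
  "quad_conj c z = (THE w. \<exists>r s. z = of_rat r + of_rat s * c \<and> w = of_rat r - of_rat s * c)"

definition poly_conj :: "complex \<Rightarrow> complex poly \<Rightarrow> complex poly" where
  "poly_conj c = map_poly (quad_conj c)"


section \<open>The two definite descriptions are well defined\<close>

lemma quad_conj_eq:
  assumes "c \<notin> \<rat>"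
  shows "quad_conj c (of_rat r + of_rat s * c) = of_rat r - of_rat s * c"
  unfolding quad_conj_def
proof (rule the_equality)
  fix w assume "\<exists>r' s'. of_rat r + of_rat s * c = of_rat r' + of_rat s' * c \<and>
                  w = of_rat r' - of_rat s' * c"
  then obtain r' s' where eq: "of_rat r + of_rat s * c = of_rat r' + of_rat s' * c"
    and w: "w = of_rat r' - of_rat s' * c" by blast
  have "s = s'"
  proof (rule ccontr)
    assume "s \<noteq> s'"
    then have ne: "of_rat (s - s') \<noteq> (0::complex)" by simp
    have "of_rat (s - s') * c = of_rat (r' - r)"
      using eq by (simp add: of_rat_diff algebra_simps)
    then have "c = of_rat ((r' - r) / (s - s'))"
      using ne by (simp add: of_rat_divide nonzero_eq_divide_eq mult.commute)
    then show False using assms by (metis Rats_of_rat)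
  qed
  with eq w show "w = of_rat r - of_rat s * c" by simp
qed blast

lemma poly_to_fls_nth:
  "poly_to_fls p $$ n = (if n \<le> 0 then coeff p (nat (- n)) else 0)"
proof (induction p arbitrary: n)
  case 0
  then show ?case by (simp add: poly_to_fls_def)
next
  case (pCons c p)
  have "poly_to_fls (pCons c p) = fls_const c + fls_X_inv * poly_to_fls p"
    by (simp add: poly_to_fls_def map_poly_pCons)
  then have "poly_to_fls (pCons c p) $$ n = (if n = 0 then c else 0) + poly_to_fls p $$ (n + 1)"
    by (simp add: fls_X_inv_times_conv_shift)
  also have "\<dots> = (if n \<le> 0 then coeff (pCons c p) (nat (- n)) else 0)"
    unfolding pCons.IH
    by (cases "nat (- n)") (auto simp: coeff_pCons nat_diff_distrib intro!: arg_cong[of _ _ "coeff p"])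
  finally show ?case .
qed

lemma fls_sqrt_ex1:
  assumes "lead_coeff D = 1" and deg: "degree D = 2 * n"
  shows "\<exists>!y. y\<^sup>2 = poly_to_fls D \<and> y $$ fls_subdegree y = 1"
proof (rule ex_ex1I)
  define s where "s = fps_radical (\<lambda>_ _. 1) 2 (fps_of_poly (reflect_poly D))"
  have "D \<noteq> 0" using assms by auto
  then have D0: "fps_of_poly (reflect_poly D) $ 0 = 1" using assms by simp
  have s2: "s\<^sup>2 = fps_of_poly (reflect_poly D)"
    using power_radical[of "fps_of_poly (reflect_poly D)" "\<lambda>_ _. 1" 1] D0 \<open>D \<noteq> 0\<close>
    by (simp add: s_def numeral_2_eq_2)
  have s0: "s $ 0 = 1" by (simp add: s_def)
  define y where "y = fls_shift (int n) (fps_to_fls s)"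
  have "y\<^sup>2 = fls_shift (int (2 * n)) (fps_to_fls (s\<^sup>2))"
    by (simp add: y_def power2_eq_square fls_times_fps_to_fls fls_shifted_times_simps)
  also have "\<dots> = poly_to_fls D"
    unfolding s2
    by (intro fls_eqI) (auto simp: poly_to_fls_nth coeff_reflect_poly deg nat_diff_distrib
        intro!: arg_cong[of _ _ "coeff D"] coeff_eq_0)
  finally have "y\<^sup>2 = poly_to_fls D" .
  moreover have "fls_subdegree y = - int n"
    by (rule fls_subdegree_eqI) (auto simp: y_def s0)
  then have "y $$ fls_subdegree y = 1" by (simp add: y_def s0)
  ultimately show "\<exists>y. y\<^sup>2 = poly_to_fls D \<and> y $$ fls_subdegree y = 1" by blast
next
  fix y z :: "rat fls"
  assume y: "y\<^sup>2 = poly_to_fls D \<and> y $$ fls_subdegree y = 1"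
    and z: "z\<^sup>2 = poly_to_fls D \<and> z $$ fls_subdegree z = 1"
  then have "y = z \<or> y = - z" by (metis power2_eq_iff)
  moreover have "y \<noteq> - z" using y z by auto
  ultimately show "y = z" by blast
qed

end

theory Submission
  imports Defs "HOL-Computational_Algebra.Field_as_Ring"
begin

text \<open>
  Part (a) concerns continuants. Let \<open>r\<close> be even, let \<open>p / q\<close> be the convergent \<open>[A, a\<^sub>1, \<dots>, a\<^sub>r\<^sub>-\<^sub>1]\<close>
  and suppose \<open>p\<^sup>2 - D q\<^sup>2 = \<kappa>\<close> is a nonzero constant. The determinant identity for continuants gives
  \<open>p q' = 1\<close> modulo \<open>q\<close>, where \<open>q'\<close> is the preceding denominator, so the norm equation becomes
  \<open>p = \<kappa> q'\<close> modulo \<open>q\<close>. On the other hand \<open>p\<close> is congruent to the continuant of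
  \<open>a\<^sub>2, \<dots>, a\<^sub>r\<^sub>-\<^sub>1\<close>, while \<open>q'\<close> is that of \<open>a\<^sub>1, \<dots>, a\<^sub>r\<^sub>-\<^sub>2\<close>. For degree reasons the congruence is an
  equation between these two, and the Euclidean algorithm turns it into the symmetry
  \<open>a\<^sub>j = \<kappa> a\<^sub>r\<^sub>-\<^sub>j\<close> or \<open>a\<^sub>r\<^sub>-\<^sub>j = \<kappa> a\<^sub>j\<close> according to the parity of \<open>j\<close>
  (\<open>cont_symmetry_up_to_scaling\<close>). Since \<open>r\<close> is even there is a middle entry \<open>a\<^sub>r\<^sub>/\<^sub>2\<close>, and it forces \<open>\<kappa> = 1\<close> (\<open>even_convergent_constant_norm_eq_1\<close>). The degree
  arguments need \<open>a\<^sub>1, a\<^sub>2, \<dots>\<close> to be nonconstant, which holds because \<open>y\<close> is not a rational function.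

  Parts (b) and (c) concern the equation \<open>(a + c) (a - c) = D b\<^sup>2\<close>. The two factors on the left are
  coprime, as their difference is the nonzero constant \<open>2 c\<close>. Hence \<open>b\<close> splits into a divisor \<open>d\<^sub>+\<close> of
  \<open>a + c\<close> and a divisor \<open>d\<^sub>-\<close> of \<open>a - c\<close>, and coprimality lets the squares divide as well
  (\<open>coprime_split_square\<close>). If \<open>c\<close> is rational and \<open>(a + c) / d\<^sub>+\<^sup>2\<close> were a constant \<open>l\<close>, then
  \<open>l d\<^sub>+ + d\<^sub>- y\<close> would be a unit of half the degree of \<open>a + b y\<close>
  (\<open>unit_norm_factor_nonconstant\<close>). If \<open>c\<close> is irrational, then \<open>d\<^sub>+\<close> can be chosen as the monic
  greatest common divisor of \<open>b\<close> and \<open>a + c\<close>. It has coefficients in \<open>\<rat>(c)\<close>, because the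
  Euclidean algorithm does not leave this field, and conjugation takes it to the greatest common
  divisor of \<open>b\<close> and \<open>a - c\<close> (\<open>poly_conj_gcd\<close>), which is \<open>d\<^sub>-\<close>.
\<close>

section \<open>Splitting a polynomial between two coprime factors\<close>

lemma associated_same_lead_coeff_imp_eq:
  fixes p q :: "'a::field poly"
  assumes "p dvd q" "q dvd p" "lead_coeff p = lead_coeff q"
  shows "p = q"
proof (cases "p = 0")
  case False
  obtain t where t: "q = p * t" using assms(1) by blast
  have "t dvd 1" using assms(2) False t by auto
  then obtain u where u: "t = [:u:]" by (auto simp: is_unit_poly_iff)
  then show ?thesis using t assms(3) False by (auto simp: lead_coeff_smult split: if_splits)
qed (use assms in auto)

lemma lead_coeff_normalize:
  fixes p :: "'a::field_gcd poly"
  assumes "p \<noteq> 0"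
  shows "lead_coeff (normalize p) = 1"
proof -
  have "lead_coeff (normalize p) \<noteq> 0" using assms leading_coeff_0_iff[of "normalize p"] by (simp del: leading_coeff_0_iff)
  then have "lead_coeff (normalize p) dvd 1" by (simp add: dvd_field_iff del: leading_coeff_0_iff)
  moreover have "unit_factor (normalize p) = 1" using assms by simp
  then have "unit_factor (lead_coeff (normalize p)) = 1"
    by (simp add: unit_factor_poly_def one_pCons)
  ultimately show ?thesis using is_unit_unit_factor by metis
qed

lemma lead_coeff_gcd:
  fixes p q :: "'a::field_gcd poly"
  assumes "p \<noteq> 0"
  shows "lead_coeff (gcd p q) = 1"
  using lead_coeff_normalize[of "gcd p q"] assms by simp

text \<open>
  \<open>dp\<close> divides \<open>X\<close>, so \<open>dp\<^sup>2\<close> is coprime to \<open>Y\<close>; but it divides \<open>X * Y\<close>.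
\<close>

lemma coprime_split_square:
  fixes b X Y D :: "'a::field_gcd poly"
  assumes "coprime X Y" "D * b\<^sup>2 = X * Y" "b = dp * dm" "dp dvd X" "dm dvd Y" "b \<noteq> 0"
  shows "dp\<^sup>2 dvd X" "dm\<^sup>2 dvd Y" "D = (X div dp\<^sup>2) * (Y div dm\<^sup>2)"
proof -
  have eq: "X * Y = dp\<^sup>2 * (D * dm\<^sup>2)" "X * Y = dm\<^sup>2 * (D * dp\<^sup>2)"
    using assms(2,3) by (simp_all add: power_mult_distrib mult_ac)
  have "coprime (dp\<^sup>2) Y" "coprime (dm\<^sup>2) X"
    using assms(1,4,5) by (meson coprime_commute coprime_divisors coprime_power_left_iff dvd_refl)+
  then show dp: "dp\<^sup>2 dvd X" and dm: "dm\<^sup>2 dvd Y"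
    using eq by (metis coprime_dvd_mult_left_iff dvd_triv_left, metis coprime_dvd_mult_right_iff dvd_triv_left)
  obtain s t where s: "X = dp\<^sup>2 * s" and t: "Y = dm\<^sup>2 * t" using dp dm by blast
  have "(dp\<^sup>2 * dm\<^sup>2) * D = X * Y" using eq(1) by (simp only: mult_ac)
  also have "\<dots> = (dp\<^sup>2 * dm\<^sup>2) * (s * t)" unfolding s t by (simp only: mult_ac)
  finally have "(dp\<^sup>2 * dm\<^sup>2) * D = (dp\<^sup>2 * dm\<^sup>2) * (s * t)" .
  moreover have "dp\<^sup>2 * dm\<^sup>2 \<noteq> 0" using assms(3,6) by auto
  ultimately have "D = s * t" using mult_left_cancel by blast
  then show "D = (X div dp\<^sup>2) * (Y div dm\<^sup>2)" using s t assms(3,6) by simp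
qed

lemma coprime_add_sub_const:
  fixes a :: "'a::field_gcd poly"
  assumes "c + c \<noteq> 0"
  shows "coprime (a + [:c:]) (a - [:c:])"
proof (rule coprimeI)
  fix d assume "d dvd a + [:c:]" "d dvd a - [:c:]"
  then have "d dvd (a + [:c:]) - (a - [:c:])" by (rule dvd_diff)
  then have "d dvd [:c + c:]" by simp
  moreover have "[:c + c:] dvd 1" using assms by (simp add: is_unit_const_poly_iff dvd_field_iff del: mult_2)
  ultimately show "d dvd 1" by (rule dvd_trans)
qed

text \<open>
  Were \<open>s\<close> a constant \<open>l\<close>, the element with components \<open>l dp\<close> and \<open>dm\<close> would have norm
  \<open>l (dp\<^sup>2 s) - l (dm\<^sup>2 t) = 2 c l\<close> and only half the degree of \<open>a\<close>, against minimality.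
\<close>

lemma unit_norm_factor_nonconstant:
  fixes D a b :: "rat poly"
  assumes min: "\<And>a' b'. nontrivial_qunit D a' b' \<Longrightarrow> degree a \<le> degree a'"
    and "degree a > 0" "c \<noteq> 0" "a + [:c:] = dp\<^sup>2 * s" "a - [:c:] = dm\<^sup>2 * t" "D = s * t"
  shows "degree s > 0"
proof (rule ccontr)
  assume "\<not> degree s > 0"
  then obtain l where l: "s = [:l:]" by (auto elim: degree_eq_zeroE)
  have dega: "degree (a + [:c:]) = degree a" using assms(2) by (simp add: degree_add_eq_left)
  then have "a + [:c:] \<noteq> 0" using assms(2) by auto
  then have l0: "l \<noteq> 0" and dp0: "dp \<noteq> 0" using l assms(4) by auto
  have deg: "2 * degree dp = degree a"
    using dega assms(4) l l0 dp0 by (simp add: degree_power_eq)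
  have "qnorm D (smult l dp) dm = [:l:] * (dp\<^sup>2 * s) - [:l:] * (dm\<^sup>2 * t)"
    using l assms(6) by (simp add: qnorm_def power2_eq_square algebra_simps)
  also have "\<dots> = [:l:] * ((a + [:c:]) - (a - [:c:]))"
    by (simp only: assms(4,5)[symmetric] right_diff_distrib)
  also have "\<dots> = [:l * (c + c):]" by simp
  finally have "nontrivial_qunit D (smult l dp) dm"
    using l0 assms(2,3) deg unfolding nontrivial_qunit_def qunit_def by auto
  from min[OF this] deg l0 assms(2) show False by auto
qed

section \<open>Polynomials with coefficients in a subfield\<close>

text \<open>
  The homomorphism property is required on a subset \<open>K\<close> only, since conjugation of \<open>\<rat>(c)\<close> has
  unspecified values at the other complex numbers.
\<close>

lemma map_poly_hom_mult:
  fixes f :: "'a::comm_ring_1 \<Rightarrow> 'b::comm_ring_1"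
  assumes "f 0 = 0" "0 \<in> K" "\<And>x y. x \<in> K \<Longrightarrow> y \<in> K \<Longrightarrow> x + y \<in> K \<and> x * y \<in> K"
    and "\<And>x y. x \<in> K \<Longrightarrow> y \<in> K \<Longrightarrow> f (x + y) = f x + f y"
    and "\<And>x y. x \<in> K \<Longrightarrow> y \<in> K \<Longrightarrow> f (x * y) = f x * f y"
    and "set (coeffs p) \<subseteq> K" "set (coeffs q) \<subseteq> K"
  shows "map_poly f (p * q) = map_poly f p * map_poly f q"
proof (rule poly_eqI)
  fix n
  have K: "coeff p i \<in> K" "coeff q i \<in> K" for i
    using assms(2,6,7) by (auto simp: coeffs_def split: if_splits; metis coeff_in_coeffs coeff_eq_0 le_less_linear subsetD)+
  have sum: "sum h A \<in> K \<and> f (sum h A) = (\<Sum>x\<in>A. f (h x))" if "finite A" "\<And>x. h x \<in> K" 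
    for h :: "nat \<Rightarrow> 'a" and A
    using that by (induction A rule: finite_induct) (use assms in auto)
  show "coeff (map_poly f (p * q)) n = coeff (map_poly f p * map_poly f q) n"
    using sum[of "{..n}" "\<lambda>i. coeff p i * coeff q (n - i)"] K assms(1,3,5)
    by (simp add: coeff_map_poly coeff_mult)
qed

text \<open>
  Polynomials over \<open>\<rat>(c)\<close> are treated as complex polynomials with restricted coefficients: \<open>c\<close> varies,
  so \<open>\<rat>(c)\<close> is a set and not a type. What has to be shown is that quotients, remainders and greatest
  common divisors computed over the large field stay over the small one.
\<close>

locale subfield_set =
  fixes K :: "'a::field_gcd set"
  assumes zero_closed: "0 \<in> K" and one_closed: "1 \<in> K"
    and diff_closed: "\<And>x y. x \<in> K \<Longrightarrow> y \<in> K \<Longrightarrow> x - y \<in> K"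
    and mult_closed: "\<And>x y. x \<in> K \<Longrightarrow> y \<in> K \<Longrightarrow> x * y \<in> K"
    and inverse_closed: "\<And>x. x \<in> K \<Longrightarrow> inverse x \<in> K"
begin

definition over :: "'a poly \<Rightarrow> bool" where
  "over p \<longleftrightarrow> (\<forall>i. coeff p i \<in> K)"

lemma over_iff_coeffs: "over p \<longleftrightarrow> set (coeffs p) \<subseteq> K"
proof -
  have "range (coeff p) \<subseteq> K \<longleftrightarrow> set (coeffs p) \<subseteq> K"
    using zero_closed by (simp add: range_coeff)
  then show ?thesis by (auto simp: over_def)
qed

lemma add_closed: "x \<in> K \<Longrightarrow> y \<in> K \<Longrightarrow> x + y \<in> K"
  using diff_closed[of x "0 - y"] diff_closed[of 0 y] zero_closed by simp

lemma over_0: "over 0" by (simp add: over_def zero_closed)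

lemma over_diff: "over p \<Longrightarrow> over q \<Longrightarrow> over (p - q)"
  by (simp add: over_def diff_closed)

lemma over_add: "over p \<Longrightarrow> over q \<Longrightarrow> over (p + q)"
  by (simp add: over_def add_closed)

lemma over_monom: "x \<in> K \<Longrightarrow> over (monom x n)"
  by (simp add: over_def zero_closed)

lemma over_mult: "over p \<Longrightarrow> over q \<Longrightarrow> over (p * q)"
  unfolding over_def coeff_mult
proof
  fix n assume *: "\<forall>i. coeff p i \<in> K" "\<forall>i. coeff q i \<in> K"
  have "sum h A \<in> K" if "finite A" "\<And>x. h x \<in> K" for h :: "nat \<Rightarrow> 'a" and A
    using that by (induction A rule: finite_induct) (auto simp: zero_closed add_closed)
  then show "(\<Sum>i\<le>n. coeff p i * coeff q (n - i)) \<in> K" using * mult_closed by simp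
qed

text \<open>
  The steps of long division use only field operations on coefficients. As quotient and remainder
  are unique, those over the large field are the ones found over \<open>K\<close>.
\<close>

lemma over_div_mod:
  assumes "over p" "over q"
  shows "over (p div q) \<and> over (p mod q)"
proof (cases "q = 0")
  case True
  then show ?thesis using assms over_0 by simp
next
  case False
  show ?thesis using assms(1)
  proof (induction "length (coeffs p)" arbitrary: p rule: less_induct)
    case less
    show ?case
    proof (cases "p = 0 \<or> degree p < degree q")
      case True
      then show ?thesis using less.prems over_0 by (auto simp: div_poly_less mod_poly_less)
    next
      case ge: False
      define t where "t = monom (lead_coeff p * inverse (lead_coeff q)) (degree p - degree q)"
      define p' where "p' = p - t * q"
      have t: "over t" unfolding t_def
        using less.prems assms(2) by (intro over_monom mult_closed inverse_closed) (auto simp: over_def)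
      have p': "over p'" unfolding p'_def using t less.prems assms(2) by (intro over_diff over_mult)
      have t0: "t \<noteq> 0" using ge False by (simp add: t_def)
      have "degree (t * q) = degree p"
        using t0 False ge by (simp add: degree_mult_eq) (simp add: t_def degree_monom_eq)
      moreover have "lead_coeff (t * q) = lead_coeff p"
        using False using ge by (auto simp: lead_coeff_mult t_def degree_monom_eq)
      ultimately have "coeff p' (degree p) = 0" "degree p' \<le> degree p"
        unfolding p'_def by (simp, metis degree_diff_le order_refl)
      then have "p' = 0 \<or> degree p' < degree p"
        using eq_zero_or_degree_less by blast
      then have "length (coeffs p') < length (coeffs p)"
        using ge by (cases "p' = 0") (auto simp: length_coeffs)
      note IH = less.hyps[OF this p']
      have "p = p' + t * q" by (simp add: p'_def)
      then have "p div q = t + p' div q" "p mod q = p' mod q"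
        using False by (metis div_mult_self1, metis mod_mult_self1)
      then show ?thesis using IH t over_add by simp
    qed
  qed
qed

lemma over_gcd:
  assumes "over p" "over q"
  shows "over (gcd p q)"
  using assms
proof (induction p q rule: eucl_induct)
  case (zero p)
  have "normalize p = p * [:inverse (lead_coeff p):]"
  proof (cases "p = 0")
    case False
    then have "unit_factor p = [:lead_coeff p:]"
      by (simp add: unit_factor_poly_def is_unit_unit_factor dvd_field_iff)
    then have "p * [:inverse (lead_coeff p):] = normalize p * ([:lead_coeff p:] * [:inverse (lead_coeff p):])"
      by (metis mult.assoc normalize_mult_unit_factor)
    moreover have "[:lead_coeff p:] * [:inverse (lead_coeff p):] = 1" using False by (simp add: one_pCons)
    ultimately show ?thesis by (metis mult.right_neutral)
  qed simp
  moreover have "over [:inverse (lead_coeff p):]"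
    using over_monom[of "inverse (lead_coeff p)" 0] zero inverse_closed by (simp add: over_def monom_0)
  ultimately have "over (normalize p)" using over_mult[OF zero(1)] by (simp only:)
  then show ?case by simp
next
  case (mod p q)
  then show ?case using over_div_mod by (metis gcd_mod_right gcd.commute)
qed

end


section \<open>Conjugation on polynomials over a quadratic field\<close>

lemma quad_field_subfield:
  assumes "c \<notin> \<rat>" "c\<^sup>2 = of_rat k"
  shows "subfield_set (quad_field c)"
proof
  have cc: "c * c = of_rat k" using assms(2) by (simp add: power2_eq_square)
  show "0 \<in> quad_field c" "1 \<in> quad_field c"
    unfolding quad_field_def by (auto intro: exI[of _ 0] exI[of _ 1])
  fix x assume "x \<in> quad_field c"
  then obtain r s where x: "x = of_rat r + of_rat s * c" by (auto simp: quad_field_def)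
  { fix y assume "y \<in> quad_field c"
    then obtain r' s' where y: "y = of_rat r' + of_rat s' * c" by (auto simp: quad_field_def)
    have "x - y = of_rat (r - r') + of_rat (s - s') * c"
      by (simp add: x y of_rat_diff algebra_simps)
    then show "x - y \<in> quad_field c" by (auto simp: quad_field_def)
    have "x * y = of_rat r * of_rat r' + of_rat s * of_rat s' * (c * c)
        + (of_rat r * of_rat s' + of_rat s * of_rat r') * c"
      by (simp add: x y algebra_simps)
    also have "\<dots> = of_rat (r * r' + s * s' * k) + of_rat (r * s' + s * r') * c"
      by (simp add: cc of_rat_add of_rat_mult)
    finally show "x * y \<in> quad_field c" by (auto simp: quad_field_def) }
  show "inverse x \<in> quad_field c"
  proof (cases "x = 0")
    case True
    then show ?thesis using \<open>0 \<in> quad_field c\<close> by simp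
  next
    case False
    (* N is the norm of x; the denominator is rationalised with the conjugate of x. *)
    define N where "N = r\<^sup>2 - k * s\<^sup>2"
    have N: "x * (of_rat r - of_rat s * c) = of_rat N"
    proof -
      have "x * (of_rat r - of_rat s * c) = of_rat r * of_rat r - of_rat s * of_rat s * (c * c)"
        by (simp add: x algebra_simps)
      then show ?thesis
        by (simp add: N_def cc of_rat_diff of_rat_mult power2_eq_square)
    qed
    have "of_rat r - of_rat s * c \<noteq> 0"
    proof
      assume *: "of_rat r - of_rat s * c = 0"
      show False
      proof (cases "s = 0")
        case True
        then show False using * x \<open>x \<noteq> 0\<close> by simp
      next
        case False
        then have "c = of_rat (r / s)" using * by (simp add: of_rat_divide field_simps)
        then show False using assms(1) by simp
      qed
    qed
    then have "of_rat N \<noteq> (0::complex)" using N False by (metis mult_eq_0_iff)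
    then have "inverse x = (of_rat r - of_rat s * c) / of_rat N"
      using N False by (simp add: field_simps)
    also have "\<dots> = of_rat (r / N) + of_rat (- s / N) * c"
      by (simp add: of_rat_divide of_rat_minus diff_divide_distrib)
    finally show ?thesis unfolding quad_field_def by blast
  qed
qed

lemma of_rat_in_quad_field: "of_rat r \<in> quad_field c"
  unfolding quad_field_def by (auto intro: exI[of _ r] exI[of _ 0])

lemma quad_conj_of_rat:
  assumes "c \<notin> \<rat>"
  shows "quad_conj c (of_rat r) = of_rat r"
  using quad_conj_eq[OF assms, of r 0] by simp

lemma quad_conj_generator:
  assumes "c \<notin> \<rat>"
  shows "quad_conj c c = - c"
  using quad_conj_eq[OF assms, of 0 1] by simp

lemma quad_conj_hom:
  assumes "c \<notin> \<rat>" "c\<^sup>2 = of_rat k" "x \<in> quad_field c" "y \<in> quad_field c"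
  shows "quad_conj c (x + y) = quad_conj c x + quad_conj c y"
    and "quad_conj c (x * y) = quad_conj c x * quad_conj c y"
proof -
  have cc: "c * c = of_rat k" using assms(2) by (simp add: power2_eq_square)
  obtain r s where x: "x = of_rat r + of_rat s * c" using assms by (auto simp: quad_field_def)
  obtain r' s' where y: "y = of_rat r' + of_rat s' * c" using assms by (auto simp: quad_field_def)
  have "x + y = of_rat (r + r') + of_rat (s + s') * c"
    by (simp add: x y of_rat_add algebra_simps)
  then show "quad_conj c (x + y) = quad_conj c x + quad_conj c y"
    by (simp only: quad_conj_eq[OF assms(1)] x y) (simp add: of_rat_add algebra_simps)
  have "x * y = of_rat r * of_rat r' + of_rat s * of_rat s' * (c * c)
      + (of_rat r * of_rat s' + of_rat s * of_rat r') * c"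
    by (simp add: x y algebra_simps)
  then have "x * y = of_rat (r * r' + s * s' * k) + of_rat (r * s' + s * r') * c"
    by (simp add: cc of_rat_add of_rat_mult)
  then have "quad_conj c (x * y) = of_rat r * of_rat r' + of_rat s * of_rat s' * (c * c)
      - (of_rat r * of_rat s' + of_rat s * of_rat r') * c"
    by (simp only: quad_conj_eq[OF assms(1)]) (simp add: cc of_rat_add of_rat_mult)
  then show "quad_conj c (x * y) = quad_conj c x * quad_conj c y"
    by (simp only: x y quad_conj_eq[OF assms(1)]) (simp add: algebra_simps)
qed

lemma quad_conj_involution:
  assumes "c \<notin> \<rat>" "x \<in> quad_field c"
  shows "quad_conj c x \<in> quad_field c" "quad_conj c (quad_conj c x) = x"
proof -
  obtain r s where x: "x = of_rat r + of_rat s * c" using assms by (auto simp: quad_field_def)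
  have c: "quad_conj c x = of_rat r + of_rat (- s) * c"
    by (simp add: x quad_conj_eq[OF assms(1)] of_rat_minus)
  then show "quad_conj c x \<in> quad_field c" unfolding quad_field_def by blast
  show "quad_conj c (quad_conj c x) = x"
    unfolding c quad_conj_eq[OF assms(1)] by (simp add: x of_rat_minus)
qed

lemma poly_conj_dvd:
  assumes c: "c \<notin> \<rat>" "c\<^sup>2 = of_rat k"
    and "set (coeffs p) \<subseteq> quad_field c" "set (coeffs q) \<subseteq> quad_field c" "p dvd q"
  shows "poly_conj c p dvd poly_conj c q"
proof -
  interpret subfield_set "quad_field c" using quad_field_subfield[OF c] .
  have q: "q = p * (q div p)" using assms(5) by simp
  have "set (coeffs (q div p)) \<subseteq> quad_field c"
    using over_div_mod assms(3,4) over_iff_coeffs by blast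
  then have "poly_conj c (p * (q div p)) = poly_conj c p * poly_conj c (q div p)"
    unfolding poly_conj_def
    using assms(3) zero_closed add_closed mult_closed quad_conj_hom[OF c] quad_conj_of_rat[OF c(1), of 0]
    by (intro map_poly_hom_mult[where K = "quad_field c"]) auto
  then show ?thesis using q by (metis dvd_triv_left)
qed

lemma poly_conj_coeffs:
  assumes "c \<notin> \<rat>" "c\<^sup>2 = of_rat k" "set (coeffs p) \<subseteq> quad_field c"
  shows "set (coeffs (poly_conj c p)) \<subseteq> quad_field c" "poly_conj c (poly_conj c p) = p"
    and "degree (poly_conj c p) = degree p"
proof -
  interpret subfield_set "quad_field c" using quad_field_subfield[OF assms(1,2)] .
  have 0: "quad_conj c 0 = 0" using quad_conj_of_rat[OF assms(1), of 0] by simp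
  have K: "coeff p i \<in> quad_field c" for i
    using assms(3) over_iff_coeffs over_def by blast
  have "over (poly_conj c p)"
    unfolding over_def poly_conj_def by (simp add: coeff_map_poly 0 quad_conj_involution[OF assms(1) K])
  then show "set (coeffs (poly_conj c p)) \<subseteq> quad_field c" using over_iff_coeffs by blast
  show inv: "poly_conj c (poly_conj c p) = p"
    by (rule poly_eqI)
      (simp add: poly_conj_def coeff_map_poly 0 quad_conj_involution[OF assms(1) K])
  show "degree (poly_conj c p) = degree p"
    using map_poly_degree_leq[of "quad_conj c" p] map_poly_degree_leq[of "quad_conj c" "poly_conj c p"]
    using inv by (simp add: poly_conj_def)
qed

text \<open>
  Each side divides the other: conjugation preserves divisibility over \<open>\<rat>(c)\<close>, and being an
  involution it can be applied in both directions. Both sides are monic.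
\<close>

lemma poly_conj_gcd:
  assumes c: "c \<notin> \<rat>" "c\<^sup>2 = of_rat k"
    and p: "set (coeffs p) \<subseteq> quad_field c" and q: "set (coeffs q) \<subseteq> quad_field c"
    and "p \<noteq> 0"
  shows "poly_conj c (gcd p q) = gcd (poly_conj c p) (poly_conj c q)"
proof -
  interpret subfield_set "quad_field c" using quad_field_subfield[OF c] .
  define d where "d = gcd p q"
  define e where "e = gcd (poly_conj c p) (poly_conj c q)"
  note conj = poly_conj_coeffs[OF c]
  have d: "set (coeffs d) \<subseteq> quad_field c" unfolding d_def
    using over_gcd[of p q] p q by (simp add: over_iff_coeffs)
  have e: "set (coeffs e) \<subseteq> quad_field c" unfolding e_def
    using over_gcd[of "poly_conj c p" "poly_conj c q"] conj(1)[OF p] conj(1)[OF q]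
    by (simp add: over_iff_coeffs)
  have "poly_conj c d dvd e" unfolding e_def
    using poly_conj_dvd[OF c d p] poly_conj_dvd[OF c d q] by (simp add: d_def)
  moreover have "poly_conj c e dvd d"
    using poly_conj_dvd[OF c e conj(1)[OF p]] poly_conj_dvd[OF c e conj(1)[OF q]]
    by (simp add: d_def e_def conj(2) p q)
  then have "e dvd poly_conj c d"
    using poly_conj_dvd[OF c conj(1)[OF e] d] conj(2)[OF e] by simp
  moreover have "lead_coeff d = 1"
    using lead_coeff_gcd[OF \<open>p \<noteq> 0\<close>] by (simp add: d_def)
  then have "lead_coeff (poly_conj c d) = 1"
    using conj(3)[OF d] quad_conj_of_rat[OF c(1), of 0] quad_conj_of_rat[OF c(1), of 1]
    by (simp add: poly_conj_def coeff_map_poly)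
  moreover have "poly_conj c p \<noteq> 0"
    using conj(2)[OF p] \<open>p \<noteq> 0\<close> by (auto simp: poly_conj_def)
  then have "lead_coeff e = 1" unfolding e_def by (rule lead_coeff_gcd)
  ultimately have "poly_conj c d = e" by (intro associated_same_lead_coeff_imp_eq) auto
  then show ?thesis by (simp add: d_def e_def)
qed

section \<open>Continuants\<close>

text \<open>
  \<open>cont a i (Suc n)\<close> is the continuant of the \<open>n\<close> entries \<open>a i, \<dots>, a (i + n - 1)\<close>. The shift by one
  leaves room for the value \<open>0\<close> of the continuant of length \<open>- 1\<close>, so that the recurrences hold
  down to the shortest cases, and a window may start at any index.
\<close>

fun cont :: "(nat \<Rightarrow> 'a::comm_ring_1) \<Rightarrow> nat \<Rightarrow> nat \<Rightarrow> 'a" where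
  "cont a i 0 = 0"
| "cont a i (Suc 0) = 1"
| "cont a i (Suc (Suc n)) = a (i + n) * cont a i (Suc n) + cont a i n"

lemma cf_den_eq_cont: "cf_den y r = cont (partial_quot y) 1 r"
  by (induction y r rule: cf_den.induct) simp_all

lemma cf_num_eq_cont: "cf_num y r = cont (partial_quot y) 0 (Suc r)"
  by (induction y r rule: cf_num.induct) simp_all

text \<open>
  The recursion in the definition removes the last entry. Removing the first entry gives the same
  kind of recurrence, which is why a continuant does not change when its entries are reversed; the
  two recurrences together replace any explicit reversal below.
\<close>

lemma cont_expand_front:
  "cont a i (Suc (Suc n)) = a i * cont a (Suc i) (Suc n) + cont a (Suc (Suc i)) n"
proof (induction n rule: less_induct)
  case (less n)
  consider "n = 0" | "n = 1" | k where "n = Suc (Suc k)"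
    by (metis One_nat_def not0_implies_Suc)
  then show ?case
  proof cases
    case 3
    have "cont a i (Suc (Suc n)) = a (i + n) * cont a i (Suc (Suc (Suc k))) + cont a i (Suc (Suc k))"
      unfolding 3 by simp
    also have "\<dots> = a (i + n) * (a i * cont a (Suc i) (Suc (Suc k)) + cont a (Suc (Suc i)) (Suc k))
        + (a i * cont a (Suc i) (Suc k) + cont a (Suc (Suc i)) k)"
      using less[of "Suc k"] less[of k] 3 by simp
    also have "\<dots> = a i * cont a (Suc i) (Suc n) + cont a (Suc (Suc i)) n"
      by (simp add: 3 algebra_simps)
    finally show ?thesis .
  qed (simp_all add: algebra_simps)
qed

lemma cont_determinant:
  "cont a 0 (Suc (Suc n)) * cont a 1 n - cont a 0 (Suc n) * cont a 1 (Suc n) = (- 1) ^ Suc n"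
proof (induction n)
  case (Suc n)
  have "cont a 0 (Suc (Suc (Suc n))) * cont a 1 (Suc n) - cont a 0 (Suc (Suc n)) * cont a 1 (Suc (Suc n))
      = - (cont a 0 (Suc (Suc n)) * cont a 1 n - cont a 0 (Suc n) * cont a 1 (Suc n))"
    by (simp add: algebra_simps)
  then show ?case using Suc by (simp only: power_Suc) simp
qed simp

lemma cont_degree:
  fixes a :: "nat \<Rightarrow> 'a::field poly"
  assumes "\<And>j. j \<ge> i \<Longrightarrow> degree (a j) > 0"
  shows "cont a i (Suc n) \<noteq> 0 \<and> degree (cont a i (Suc n)) = (\<Sum>j\<in>{i..<i+n}. degree (a j))"
proof (induction n rule: less_induct)
  case (less n)
  show ?case
  proof (cases n)
    case 0
    then show ?thesis by simp
  next
    case (Suc k)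
    have a: "degree (a (i + k)) > 0" using assms by simp
    have IH: "cont a i (Suc k) \<noteq> 0" "degree (cont a i (Suc k)) = (\<Sum>j\<in>{i..<i+k}. degree (a j))"
      using less Suc by auto
    have main: "degree (a (i + k) * cont a i (Suc k)) = degree (a (i + k)) + degree (cont a i (Suc k))"
      using a IH(1) by (subst degree_mult_eq) auto
    have "degree (cont a i k) \<le> degree (cont a i (Suc k))"
    proof (cases k)
      case (Suc l)
      have "degree (cont a i (Suc l)) = (\<Sum>j\<in>{i..<i+l}. degree (a j))"
        using less[of l] Suc \<open>n = Suc k\<close> by simp
      also have "\<dots> \<le> (\<Sum>j\<in>{i..<i+k}. degree (a j))"
        using Suc by (intro sum_mono2) auto
      finally show ?thesis using IH(2) Suc by simp
    qed simp
    then have "degree (cont a i (Suc n)) = degree (a (i + k)) + degree (cont a i (Suc k))"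
      using main a Suc by (simp add: degree_add_eq_left)
    then show ?thesis using a IH(2) Suc by auto
  qed
qed

lemma cont_degree_less:
  fixes a :: "nat \<Rightarrow> 'a::field poly"
  assumes "\<And>j. j \<ge> i \<Longrightarrow> degree (a j) > 0"
  shows "cont a i n = 0 \<or> degree (cont a i n) < degree (cont a i (Suc n))"
proof (cases n)
  case (Suc k)
  then show ?thesis
    using cont_degree[of i a k, OF assms] cont_degree[of i a n, OF assms] assms[of "i + k"] by simp
qed simp

lemma quotient_remainder_unique:
  fixes x y F R S :: "'a::field poly"
  assumes "x * F + R = y * F + S" "F \<noteq> 0" "R = 0 \<or> degree R < degree F" "S = 0 \<or> degree S < degree F"
  shows "x = y \<and> R = S"
proof -
  have "(x * F + R) div F = x" "(y * F + S) div F = y"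
    using assms(2-4) by (auto simp: div_poly_less poly_div_add_left)
  then have "x = y" using assms(1) by simp
  then show ?thesis using assms(1) by auto
qed

section \<open>Twisted symmetry of the partial quotients\<close>

text \<open>
  The Euclidean algorithm is run in parallel on the pairs \<open>(cont a 1 r, cont a 2 (r - 1))\<close> and
  \<open>(cont a 1 r, cont a 1 (r - 1))\<close>: the first strips entries from the front, the second from the
  end. The second components differ by the factor \<open>\<kappa>\<close>, so uniqueness of division with remainder
  makes the quotients agree up to \<open>\<kappa>\<close> and \<open>1 / \<kappa>\<close> alternately. This is the palindromic symmetry of
  the partial quotients, twisted by \<open>\<kappa>\<close>.
\<close>

lemma cont_symmetry_up_to_scaling:
  fixes a :: "nat \<Rightarrow> 'a::field poly"
  assumes deg: "\<And>j. j \<ge> 1 \<Longrightarrow> degree (a j) > 0"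
    and "\<kappa> \<noteq> 0" and r: "j + 2 \<le> r"
    and \<mu>: "\<And>j. \<mu> j = (if even j then 1 else \<kappa>)"
    and start: "cont a 2 (r - 1) = smult \<kappa> (cont a 1 (r - 1))"
  shows "cont a (j + 1) (r - j) = smult (\<mu> j) (cont a 1 (r - j)) \<and>
    cont a (j + 2) (r - j - 1) = smult (\<mu> (j + 1)) (cont a 1 (r - j - 1)) \<and>
    smult (\<mu> (j + 1)) (a (j + 1)) = smult (\<mu> j) (a (r - j - 1))"
  using r
proof (induction j)
  have step: "cont a (j + 3) (r - j - 2) = smult (\<mu> j) (cont a 1 (r - j - 2)) \<and>
      smult (\<mu> (j + 1)) (a (j + 1)) = smult (\<mu> j) (a (r - j - 1))"
    if F: "cont a (j + 1) (r - j) = smult (\<mu> j) (cont a 1 (r - j))"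
    and F': "cont a (j + 2) (r - j - 1) = smult (\<mu> (j + 1)) (cont a 1 (r - j - 1))"
    and r: "j + 2 \<le> r" for j
  proof -
    define n where "n = r - j - 2"
    have n: "r - j = Suc (Suc n)" "r - j - 1 = Suc n" "r - j - 2 = n" using r by (auto simp: n_def)
    have \<mu>0: "\<mu> i \<noteq> 0" for i using \<mu> \<open>\<kappa> \<noteq> 0\<close> by simp
    define G where "G = cont a 1 (Suc n)"
    have G0: "G \<noteq> 0" using cont_degree[of 1 a n] deg by (simp add: G_def)
    have "smult (\<mu> (j + 1)) (a (j + 1)) * G + cont a (j + 3) n = cont a (j + 1) (r - j)"
      unfolding n(1) cont_expand_front using F' unfolding n G_def by (simp add: numeral_3_eq_3)
    also have "\<dots> = smult (\<mu> j) (a (r - j - 1)) * G + smult (\<mu> j) (cont a 1 n)"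
      unfolding F n(2) unfolding n(1) G_def by (simp add: smult_add_right)
    finally have eq: "smult (\<mu> (j + 1)) (a (j + 1)) * G + cont a (j + 3) n =
        smult (\<mu> j) (a (r - j - 1)) * G + smult (\<mu> j) (cont a 1 n)" .
    have "cont a 1 n = 0 \<or> degree (cont a 1 n) < degree G"
      unfolding G_def by (rule cont_degree_less) (rule deg)
    moreover have "cont a (j + 3) n = 0 \<or> degree (cont a (j + 3) n) < degree G"
    proof -
      have "degree (cont a (j + 2) (Suc n)) = degree G"
        using F' \<mu>0[of "j + 1"] unfolding n G_def by simp
      moreover have "cont a (j + 3) n = 0 \<or> degree (cont a (j + 3) n) < degree (cont a (j + 2) (Suc n))"
      proof (cases n)
        case (Suc k)
        have "(\<Sum>i\<in>{j+2..<j+2+n}. degree (a i)) = degree (a (j + 2)) + (\<Sum>i\<in>{j+3..<j+3+k}. degree (a i))"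
          using Suc sum.atLeast_Suc_lessThan[of "j+2" "j+2+n" "\<lambda>i. degree (a i)"] by (simp add: numeral_3_eq_3)
        moreover have "degree (a (j + 2)) > 0" using deg by simp
        ultimately show ?thesis
          using cont_degree[of "j + 3" a k] cont_degree[of "j + 2" a n] deg Suc by simp
      qed simp
      ultimately show ?thesis by simp
    qed
    ultimately show ?thesis
      using quotient_remainder_unique[OF eq G0] \<mu>0[of j] unfolding n by simp
  qed
  {
    case 0
    have "cont a (0 + 1) (r - 0) = smult (\<mu> 0) (cont a 1 (r - 0))"
      "cont a (0 + 2) (r - 0 - 1) = smult (\<mu> (0 + 1)) (cont a 1 (r - 0 - 1))"
      using start by (simp_all add: \<mu> numeral_2_eq_2)
    then show ?case using step[of 0] 0 by blast
  next
    case (Suc j)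
    have IH: "cont a (j + 1) (r - j) = smult (\<mu> j) (cont a 1 (r - j))"
      "cont a (j + 2) (r - j - 1) = smult (\<mu> (j + 1)) (cont a 1 (r - j - 1))"
      using Suc by auto
    have eqs: "Suc j + 1 = j + 2" "Suc j + 2 = j + 3" "r - Suc j = r - j - 1" "r - j - 1 - 1 = r - j - 2"
      by auto
    have "\<mu> (j + 2) = \<mu> j" by (simp add: \<mu>)
    then have "cont a (Suc j + 1) (r - Suc j) = smult (\<mu> (Suc j)) (cont a 1 (r - Suc j))"
      "cont a (Suc j + 2) (r - Suc j - 1) = smult (\<mu> (Suc j + 1)) (cont a 1 (r - Suc j - 1))"
      using IH step[OF IH] Suc.prems unfolding eqs by auto
    then show ?case using step[of "Suc j"] Suc.prems by blast
  }
qed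

text \<open>
  With \<open>p / q\<close> the convergent and \<open>q'\<close> the preceding denominator, the determinant identity says
  that \<open>p\<close> is inverse to \<open>q'\<close> modulo \<open>q\<close> when \<open>r\<close> is even, and the norm says that \<open>p\<^sup>2\<close> is \<open>\<kappa>\<close> modulo
  \<open>q\<close>. Hence \<open>p\<close> is \<open>\<kappa> q'\<close> modulo \<open>q\<close>. Expansion at the front also reduces \<open>p\<close> modulo \<open>q\<close>, to the
  continuant \<open>e\<close> of \<open>a 2, \<dots>, a (r - 1)\<close>; comparing the two starts the twisted symmetry. The entries
  \<open>a 1, \<dots>, a (r - 1)\<close> are odd in number, so there is a middle one; the symmetry maps it to itself,
  multiplied by \<open>\<kappa>\<close> or its inverse.
\<close>

lemma even_convergent_constant_norm_eq_1:
  fixes a :: "nat \<Rightarrow> 'a::field poly"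
  assumes deg: "\<And>j. j \<ge> 1 \<Longrightarrow> degree (a j) > 0"
    and r: "r > 0" "even r" and "\<kappa> \<noteq> 0"
    and norm: "(cont a 0 (Suc r))\<^sup>2 - D * (cont a 1 r)\<^sup>2 = [:\<kappa>:]"
  shows "\<kappa> = 1"
proof -
  obtain s where s: "r = Suc (Suc (2 * s))"
  proof -
    obtain t where "r = 2 * t" using r(2) by blast
    then show ?thesis using that[of "t - 1"] r(1) by simp
  qed
  define p where "p = cont a 0 (Suc r)"
  define q where "q = cont a 1 r"
  define p' where "p' = cont a 0 r"
  define q' where "q' = cont a 1 (r - 1)"
  define e where "e = cont a 2 (r - 1)"
  have det: "p * q' = 1 + p' * q"
    using cont_determinant[of a "r - 1"] s by (simp add: p_def q_def p'_def q'_def del: cont.simps)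
      (simp add: algebra_simps)
  have p: "p = a 0 * q + e"
    using cont_expand_front[of a 0 "r - 1"] s by (simp add: p_def q_def e_def numeral_2_eq_2 del: cont.simps)
  have norm': "p\<^sup>2 = [:\<kappa>:] + D * q\<^sup>2" using norm by (simp add: p_def q_def algebra_simps)
  have "smult \<kappa> q' = [:\<kappa>:] * q'" by simp
  also have "\<dots> = p * (p * q') - D * q\<^sup>2 * q'"
  proof -
    have "p * (p * q') = p\<^sup>2 * q'" by (simp add: power2_eq_square)
    then show ?thesis unfolding norm' by (simp add: algebra_simps)
  qed
  also have "\<dots> = (a 0 + p * p' - D * q * q') * q + e"
    unfolding det by (simp add: p algebra_simps power2_eq_square)
  finally have eq: "0 * q + smult \<kappa> q' = (a 0 + p * p' - D * q * q') * q + e" by simp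
  have q0: "q \<noteq> 0" and q'_less: "degree q' < degree q" and e_less: "degree e < degree q"
  proof -
    have q: "q \<noteq> 0" "degree q = (\<Sum>j\<in>{1..<1 + Suc (2 * s)}. degree (a j))"
      unfolding q_def s using cont_degree[of 1 a "Suc (2 * s)"] deg by blast+
    have "degree q' = (\<Sum>j\<in>{1..<1 + 2 * s}. degree (a j))"
      using cont_degree[of 1 a "2 * s"] deg by (simp add: q'_def s)
    then show "degree q' < degree q" using q deg[of "Suc (2 * s)"] by simp
    have "degree e = (\<Sum>j\<in>{2..<2 + 2 * s}. degree (a j))"
      using cont_degree[of 2 a "2 * s"] deg by (simp add: e_def s)
    moreover have "(\<Sum>j\<in>{1..<1 + Suc (2 * s)}. degree (a j)) =
        degree (a 1) + (\<Sum>j\<in>{2..<2 + 2 * s}. degree (a j))"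
      by (subst sum.atLeast_Suc_lessThan) (simp_all add: numeral_2_eq_2)
    ultimately show "degree e < degree q" using q deg[of 1] by simp
    show "q \<noteq> 0" by fact
  qed
  have start: "cont a 2 (r - 1) = smult \<kappa> (cont a 1 (r - 1))"
    using quotient_remainder_unique[OF eq q0] q'_less e_less \<open>\<kappa> \<noteq> 0\<close> by (simp add: e_def q'_def)
  (* At step s both ends have reached the same entry, of index s + 1 = r / 2. *)
  have "s + 2 \<le> r" and mid: "r - s - 1 = s + 1" using s by auto
  from cont_symmetry_up_to_scaling[OF deg \<open>\<kappa> \<noteq> 0\<close> this(1) refl start]
  have "smult (if even (s + 1) then 1 else \<kappa>) (a (s + 1)) = smult (if even s then 1 else \<kappa>) (a (s + 1))"
    unfolding mid by blast
  moreover have "a (s + 1) \<noteq> 0" using deg[of "s + 1"] by auto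
  ultimately show ?thesis by (auto split: if_splits dest: arg_cong[where f = lead_coeff])
qed


section \<open>Irrational Laurent series have partial quotients of positive degree\<close>

lemma poly_to_fls_mult: "poly_to_fls (p * q) = poly_to_fls p * poly_to_fls q"
proof -
  have "map_poly fls_const (p * q) = map_poly fls_const p * map_poly fls_const q"
    by (rule map_poly_hom_mult[where K = UNIV]) (auto simp: fls_plus_const fls_const_mult_const)
  then show ?thesis by (simp add: poly_to_fls_def)
qed

lemma poly_to_fls_add: "poly_to_fls (p + q) = poly_to_fls p + poly_to_fls q"
  by (rule fls_eqI) (simp add: poly_to_fls_nth)

lemma poly_to_fls_eq_iff: "poly_to_fls p = poly_to_fls q \<longleftrightarrow> p = q"
proof
  assume eq: "poly_to_fls p = poly_to_fls q"
  show "p = q"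
  proof (rule poly_eqI)
    fix n
    show "coeff p n = coeff q n"
      using arg_cong[OF eq, of "\<lambda>f. f $$ (- int n)"] by (simp add: poly_to_fls_nth)
  qed
qed simp

lemma poly_to_fls_0 [simp]: "poly_to_fls 0 = 0" 
  by (rule fls_eqI) (simp add: poly_to_fls_nth)

text \<open>
  Irrationality, unlike the mere nonvanishing of a remainder, passes from each complete quotient to
  the next, and so keeps the continued fraction from terminating.
\<close>

definition rational_fls :: "rat fls \<Rightarrow> bool" where
  "rational_fls f \<longleftrightarrow> (\<exists>p q. q \<noteq> 0 \<and> f * poly_to_fls q = poly_to_fls p)"

lemma rational_fls_diff_poly:
  assumes "rational_fls (f - poly_to_fls s)"
  shows "rational_fls f"
proof -
  obtain p q where q: "q \<noteq> 0" and "(f - poly_to_fls s) * poly_to_fls q = poly_to_fls p"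
    using assms unfolding rational_fls_def by blast
  then have "f * poly_to_fls q = poly_to_fls (p + s * q)"
    by (simp add: poly_to_fls_add poly_to_fls_mult algebra_simps)
  then show ?thesis using q unfolding rational_fls_def by blast
qed

lemma rational_fls_inverse:
  assumes "rational_fls (inverse f)"
  shows "rational_fls f"
proof (cases "f = 0")
  case True
  then have "f * poly_to_fls 1 = poly_to_fls 0" by simp
  then show ?thesis unfolding rational_fls_def using one_neq_zero by blast
next
  case False
  obtain p q where q: "q \<noteq> 0" and eq: "inverse f * poly_to_fls q = poly_to_fls p"
    using assms unfolding rational_fls_def by blast
  have "p \<noteq> 0" using eq q False poly_to_fls_eq_iff[of q 0] by auto
  moreover have "f * poly_to_fls p = poly_to_fls q"
    unfolding eq[symmetric] using False by (simp add: mult.assoc[symmetric])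
  ultimately show ?thesis unfolding rational_fls_def by blast
qed

lemma complete_quot_irrational:
  assumes "\<not> rational_fls y"
  shows "\<not> rational_fls (complete_quot y n)"
proof (induction n)
  case (Suc n)
  then show ?case
    unfolding complete_quot.simps using rational_fls_inverse rational_fls_diff_poly by blast
qed (simp add: assms)

text \<open>
  A complete quotient after the first is the inverse of a remainder that has only negative powers of
  \<open>x\<close>, and that is nonzero by irrationality. So it involves a positive power of \<open>x\<close>, that is,
  it has negative subdegree.
\<close>

lemma degree_partial_quot_pos:
  assumes "\<not> rational_fls y" "j \<ge> 1"
  shows "degree (partial_quot y j) > 0"
proof -
  obtain n where j: "j = Suc n" using assms(2) by (cases j) auto
  define h where "h = complete_quot y n - poly_to_fls (poly_part (complete_quot y n))"
  define f where "f = complete_quot y j"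
  have f: "f = inverse h" by (simp add: f_def h_def j)
  have "\<not> rational_fls f" unfolding f_def using complete_quot_irrational[OF assms(1)] .
  moreover have "rational_fls 0"
    unfolding rational_fls_def by (intro exI[of _ 0] exI[of _ 1]) simp
  ultimately have f0: "f \<noteq> 0" by auto
  then have h0: "h \<noteq> 0" using f by auto
  have "h $$ i = 0" if "i < 1" for i
    using that by (cases "i = 0") (auto simp: h_def poly_to_fls_nth poly_part_def coeff_pCons split: nat.split)
  then have "fls_subdegree h \<ge> 1" using h0 by (intro fls_subdegree_geI) auto
  then have sub: "fls_subdegree f \<le> - 1" using f by simp
  then have "coeff (poly_part f) (nat (- fls_subdegree f)) = f $$ fls_subdegree f"
    by (auto simp: poly_part_def coeff_pCons split: nat.split)
  then have "coeff (poly_part f) (nat (- fls_subdegree f)) \<noteq> 0" using f0 by simp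
  then have "nat (- fls_subdegree f) \<le> degree (poly_part f)" by (rule le_degree)
  then show ?thesis using sub by (simp add: partial_quot_def f_def)
qed

text \<open>
  If \<open>y q = p\<close> then \<open>D q\<^sup>2 = p\<^sup>2\<close>, so \<open>D\<close> is the square of \<open>p / q\<close>, hence of a polynomial;
  squarefreeness makes that polynomial a constant, against the positive degree of \<open>D\<close>.
\<close>

lemma fls_sqrt_irrational:
  assumes "lead_coeff D = 1" "squarefree D" "degree D = 2 * n" "n > 0"
  shows "\<not> rational_fls (fls_sqrt D)"
proof
  have y: "(fls_sqrt D)\<^sup>2 = poly_to_fls D"
    using theI'[OF fls_sqrt_ex1[OF assms(1,3)]] by (simp add: fls_sqrt_def)
  assume "rational_fls (fls_sqrt D)"
  then obtain p q where q: "q \<noteq> 0" and eq: "fls_sqrt D * poly_to_fls q = poly_to_fls p"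
    unfolding rational_fls_def by blast
  have "poly_to_fls (D * q\<^sup>2) = (fls_sqrt D)\<^sup>2 * (poly_to_fls q)\<^sup>2"
    unfolding y by (simp only: poly_to_fls_mult power2_eq_square)
  also have "\<dots> = poly_to_fls (p\<^sup>2)"
    by (simp only: power_mult_distrib[symmetric] eq) (simp only: poly_to_fls_mult power2_eq_square)
  finally have Dq: "D * q\<^sup>2 = p\<^sup>2" by (simp only: poly_to_fls_eq_iff)
  then have "q\<^sup>2 dvd p\<^sup>2" by (metis dvd_triv_right)
  then have "q dvd p" by simp
  then obtain t where "p = q * t" by blast
  then have "D * q\<^sup>2 = t\<^sup>2 * q\<^sup>2" using Dq by (simp add: power_mult_distrib)
  then have D: "D = t\<^sup>2" using q by simp
  then have "t dvd 1" using assms(2) unfolding squarefree_def by auto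
  then have "degree t = 0" by (auto simp: is_unit_poly_iff)
  then have "degree D = 0" using D degree_power_le[of t 2] by simp
  then show False using assms(3,4) by simp
qed

section \<open>Units and their norms\<close>

lemma coprime_of_constant_norm:
  assumes "qnorm D a b = [:k:]" "k \<noteq> 0"
  shows "coprime a b"
proof (rule coprimeI)
  fix d assume "d dvd a" "d dvd b"
  then have "d dvd qnorm D a b"
    unfolding qnorm_def power2_eq_square by (intro dvd_diff dvd_mult)
  then show "d dvd 1"
    using assms by (metis dvd_trans is_unit_const_poly_iff dvd_field_iff one_neq_zero)
qed

text \<open>
  Components of a unit are coprime because of the norm, and those of a convergent because of the
  determinant, so equal fractions differ by a constant \<open>l\<close> in both components. The scaled unit again
  has constant norm.
\<close>

lemma even_convergent_norm:
  fixes D a b :: "rat poly"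
  assumes "lead_coeff D = 1" "squarefree D" "degree D = 2 * n" "n > 0"
    and norm: "qnorm D a b = [:k:]" "k \<noteq> 0" and "a \<noteq> 0" "b \<noteq> 0"
    and r: "r > 0" "even r"
    and Fract: "Fract a b = Fract (cf_num (fls_sqrt D) r) (cf_den (fls_sqrt D) r)"
  shows "\<exists>l. l \<noteq> 0 \<and> smult l a = cf_num (fls_sqrt D) r \<and> smult l b = cf_den (fls_sqrt D) r \<and>
             qnorm D (cf_num (fls_sqrt D) r) (cf_den (fls_sqrt D) r) = 1"
proof -
  define x where "x = partial_quot (fls_sqrt D)"
  define p where "p = cont x 0 (Suc r)"
  define q where "q = cont x 1 r"
  have pq: "cf_num (fls_sqrt D) r = p" "cf_den (fls_sqrt D) r = q"
    by (simp_all add: p_def q_def x_def cf_num_eq_cont cf_den_eq_cont)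
  have deg: "degree (x j) > 0" if "j \<ge> 1" for j
    unfolding x_def using degree_partial_quot_pos[OF fls_sqrt_irrational[OF assms(1-4)] that] .
  obtain s where s: "r = Suc s" using r by (cases r) auto
  (* Fract p 0 is 0 by convention, so cross-multiplication needs a nonzero denominator. *)
  have q0: "q \<noteq> 0" using cont_degree[of 1 x s] deg by (simp add: q_def s)
  have eq: "a * q = p * b"
    using Fract \<open>b \<noteq> 0\<close> q0 by (simp add: pq eq_fract)
  have det: "p * cont x 1 s - cont x 0 r * q = (- 1) ^ r"
    unfolding p_def q_def s by (rule cont_determinant)
  have "coprime p q"
  proof (rule coprimeI)
    fix d assume "d dvd p" "d dvd q"
    then have "d dvd p * cont x 1 s - cont x 0 r * q" by simp
    then show "d dvd 1" using det r by simp
  qed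
  then have "p dvd a" using eq by (metis coprime_dvd_mult_left_iff dvd_triv_left)
  have "a dvd p"
    using eq coprime_of_constant_norm[OF norm] by (metis coprime_dvd_mult_left_iff dvd_triv_left)
  then obtain t where t: "p = a * t" by blast
  then have "t dvd 1" using \<open>p dvd a\<close> \<open>a \<noteq> 0\<close> by simp
  then obtain l where l: "t = [:l:]" "l \<noteq> 0" by (auto simp: is_unit_poly_iff dvd_field_iff)
  then have p: "p = smult l a" using t by simp
  then have "a * q = a * smult l b" using eq by simp
  then have q: "q = smult l b" using \<open>a \<noteq> 0\<close> mult_left_cancel by blast
  have "qnorm D p q = smult (l\<^sup>2) (qnorm D a b)"
    by (simp add: p q qnorm_def power2_eq_square smult_diff_right)
  then have pq_norm: "qnorm D p q = [:l\<^sup>2 * k:]" using norm by simp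
  then have "l\<^sup>2 * k = 1"
    using even_convergent_constant_norm_eq_1[of x r "l\<^sup>2 * k" D] deg r l norm(2)
    by (simp add: qnorm_def p_def q_def)
  then have "qnorm D p q = 1" using pq_norm by (simp add: one_pCons)
  then show ?thesis using p q l pq by metis
qed

text \<open>
  The two signs of \<open>c\<close> are exchanged by swapping \<open>dp\<close> and \<open>dm\<close>, so one minimality argument gives that
  both factors of \<open>D\<close> are nonconstant.
\<close>

lemma square_norm_factorization:
  fixes D a b :: "rat poly"
  assumes min: "\<And>a' b'. nontrivial_qunit D a' b' \<Longrightarrow> degree a \<le> degree a'"
    and "degree a > 0" "b \<noteq> 0" "c \<noteq> 0" and norm: "qnorm D a b = [:c\<^sup>2:]"
  shows "\<exists>dp dm. b = dp * dm \<and> dp\<^sup>2 dvd a + [:c:] \<and> dm\<^sup>2 dvd a - [:c:] \<and>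
           D = ((a + [:c:]) div dp\<^sup>2) * ((a - [:c:]) div dm\<^sup>2) \<and>
           degree ((a + [:c:]) div dp\<^sup>2) > 0 \<and> degree ((a - [:c:]) div dm\<^sup>2) > 0"
proof -
  have "[:c:]\<^sup>2 = [:c\<^sup>2:]" by (simp add: power2_eq_square)
  then have eq: "D * b\<^sup>2 = (a + [:c:]) * (a - [:c:])"
    using norm by (simp add: qnorm_def power2_eq_square algebra_simps)
  have "b dvd (a + [:c:]) * (a - [:c:])"
    unfolding eq[symmetric] by (simp add: power2_eq_square)
  then obtain dp dm where d: "b = dp * dm" "dp dvd a + [:c:]" "dm dvd a - [:c:]"
    using division_decomp by blast
  note split = coprime_split_square[OF coprime_add_sub_const eq d \<open>b \<noteq> 0\<close>]
  have c: "c + c \<noteq> 0" using \<open>c \<noteq> 0\<close> by simp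
  define s where "s = (a + [:c:]) div dp\<^sup>2"
  define t where "t = (a - [:c:]) div dm\<^sup>2"
  have s: "a + [:c:] = dp\<^sup>2 * s" and t: "a - [:c:] = dm\<^sup>2 * t" and D: "D = s * t"
    using split[OF c] by (simp_all add: s_def t_def)
  have "degree s > 0"
    using unit_norm_factor_nonconstant[of D a c dp s dm t] min \<open>degree a > 0\<close> \<open>c \<noteq> 0\<close> s t D by blast
  moreover have "degree t > 0"
  proof (rule unit_norm_factor_nonconstant[of D a "- c" dm t dp s])
    show "a + [:- c:] = dm\<^sup>2 * t" "a - [:- c:] = dp\<^sup>2 * s" "D = t * s"
      unfolding s[symmetric] t[symmetric] by (simp_all add: D mult.commute)
  qed (use min \<open>degree a > 0\<close> \<open>c \<noteq> 0\<close> in auto)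
  ultimately show ?thesis
    using d(1) split[OF c] unfolding s_def t_def by blast
qed

text \<open>
  Dividing \<open>b\<close> into arbitrary divisors of \<open>a + c\<close> and \<open>a - c\<close> need not give conjugate polynomials;
  the monic greatest common divisors are canonical and therefore do. Their product is \<open>b\<close> itself, and
  not only a constant multiple, because \<open>b\<close> is monic.
\<close>

lemma nonsquare_norm_factorization:
  fixes D a b :: "rat poly" and c :: complex
  assumes "b \<noteq> 0" and norm: "qnorm D a b = [:k:]" and c: "c \<notin> \<rat>" "c\<^sup>2 = of_rat k"
    and "lead_coeff b = 1"
  shows "\<exists>d :: complex poly. set (coeffs d) \<subseteq> quad_field c \<and>
           map_poly of_rat b = d * poly_conj c d \<and>
           d\<^sup>2 dvd map_poly of_rat a + [:c:] \<and>
           (poly_conj c d)\<^sup>2 dvd map_poly of_rat a + [:quad_conj c c:] \<and>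
           set (coeffs ((map_poly of_rat a + [:c:]) div d\<^sup>2)) \<subseteq> quad_field c \<and>
           set (coeffs ((map_poly of_rat a + [:quad_conj c c:]) div (poly_conj c d)\<^sup>2))
             \<subseteq> quad_field c \<and>
           map_poly of_rat D =
             ((map_poly of_rat a + [:c:]) div d\<^sup>2) *
             ((map_poly of_rat a + [:quad_conj c c:]) div (poly_conj c d)\<^sup>2)"
proof -
  interpret subfield_set "quad_field c" using quad_field_subfield[OF c] .
  let ?m = "map_poly (of_rat :: rat \<Rightarrow> complex)"
  define A B X Y where "A = ?m a" and "B = ?m b" and "X = A + [:c:]" and "Y = A - [:c:]"
  have mult: "?m (p * q) = ?m p * ?m q" for p q
    by (rule map_poly_hom_mult[where K = UNIV]) (auto simp: of_rat_add of_rat_mult)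
  have diff: "?m (p - q) = ?m p - ?m q" for p q
    by (rule poly_eqI) (simp add: coeff_map_poly of_rat_diff)
  have over_m: "over (?m p)" for p
    by (simp add: over_def coeff_map_poly of_rat_in_quad_field)
  have conj_m: "quad_conj c (coeff (?m p) i) = coeff (?m p) i" for p i
    by (simp add: coeff_map_poly quad_conj_of_rat[OF c(1)])
  have conj0: "quad_conj c 0 = 0" using quad_conj_of_rat[OF c(1), of 0] by simp
  have "c = of_rat 0 + of_rat 1 * c" by simp
  then have "c \<in> quad_field c" unfolding quad_field_def by blast
  then have over_c: "over [:c:]" using over_monom[of c 0] by (simp add: monom_0)
  have overs: "over A" "over B" "over X" "over Y"
    using over_m over_c over_add over_diff by (simp_all add: A_def B_def X_def Y_def)
  have "c \<noteq> 0" using c(1) by auto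
  have B0: "B \<noteq> 0" and B1: "lead_coeff B = 1"
  proof -
    have "coeff B (degree b) = 1" by (simp add: B_def coeff_map_poly assms(5))
    moreover from this have "degree b \<le> degree B" by (intro le_degree) simp
    then have "degree B = degree b"
      using map_poly_degree_leq[of of_rat b] unfolding B_def by (intro antisym)
    ultimately show "B \<noteq> 0" "lead_coeff B = 1" by auto
  qed
  have "?m [:k:] = [:c\<^sup>2:]" by (simp add: c(2) map_poly_pCons)
  then have "A * A - ?m D * (B * B) = [:c\<^sup>2:]"
    using arg_cong[OF norm, of ?m] by (simp add: qnorm_def power2_eq_square diff mult A_def B_def)
  then have eq: "?m D * B\<^sup>2 = X * Y"
    by (simp add: X_def Y_def power2_eq_square algebra_simps)
  have cop: "coprime X Y" unfolding X_def Y_def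
    using \<open>c \<noteq> 0\<close> by (intro coprime_add_sub_const) simp
  define d where "d = gcd B X"
  (* Conjugation fixes B and exchanges X and Y, hence exchanges gcd B X and gcd B Y. *)
  have conjB: "poly_conj c B = B"
    by (rule poly_eqI) (simp add: poly_conj_def coeff_map_poly[of "quad_conj c", OF conj0] conj_m B_def)
  have conjX: "poly_conj c X = Y"
  proof (rule poly_eqI)
    fix n
    have K: "coeff A n \<in> quad_field c" "coeff [:c:] n \<in> quad_field c"
      using overs over_c unfolding over_def by blast+
    have "quad_conj c (coeff [:c:] n) = - coeff [:c:] n"
      by (cases n) (simp_all add: quad_conj_generator[OF c(1)] conj0)
    then show "coeff (poly_conj c X) n = coeff Y n"
      using conj_m[of a n] quad_conj_hom(1)[OF c K]
      by (simp add: poly_conj_def coeff_map_poly[of "quad_conj c", OF conj0] X_def Y_def A_def)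
  qed
  have dbar: "poly_conj c d = gcd B Y"
    unfolding d_def using poly_conj_gcd[OF c _ _ B0, of X] overs by (simp add: over_iff_coeffs conjB conjX)
  have over_d: "over d" "over (poly_conj c d)"
    unfolding dbar unfolding d_def by (rule over_gcd; rule overs)+
  have "B dvd X * Y" unfolding eq[symmetric] by (simp add: power2_eq_square)
  then obtain u v where uv: "B = u * v" "u dvd X" "v dvd Y" using division_decomp by blast
  have "u dvd d" "v dvd poly_conj c d" unfolding dbar unfolding d_def using uv by auto
  then have "B dvd d * poly_conj c d" unfolding uv(1) by (rule mult_dvd_mono)
  moreover have "coprime d (poly_conj c d)"
    using cop unfolding dbar unfolding d_def by (meson coprime_divisors gcd_dvd2)
  then have "d * poly_conj c d dvd B"
    using divides_mult dbar d_def by (metis gcd_dvd1)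
  moreover have "lead_coeff (d * poly_conj c d) = 1"
    unfolding dbar unfolding d_def lead_coeff_mult by (simp add: lead_coeff_gcd[OF B0])
  ultimately have B: "B = d * poly_conj c d"
    using B1 by (intro associated_same_lead_coeff_imp_eq) auto
  have dX: "d dvd X" and dY: "poly_conj c d dvd Y" unfolding dbar by (simp_all add: d_def)
  note split = coprime_split_square[OF cop eq B dX dY B0]
  have Y: "?m a + [:quad_conj c c:] = Y" by (simp add: Y_def A_def quad_conj_generator[OF c(1)])
  have "over (X div d\<^sup>2)" "over (Y div (poly_conj c d)\<^sup>2)"
    unfolding power2_eq_square
    by (rule over_div_mod[THEN conjunct1]; intro over_mult overs over_d)+
  then show ?thesis
    unfolding Y using split B over_d unfolding X_def A_def B_def over_iff_coeffs by blast
qed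

theorem theorem2:
  fixes D a b :: "rat poly" and g m :: nat and k :: rat
  assumes "lead_coeff D = 1" and "squarefree D" and "degree D = 2 * g + 2"
    and "fundamental_qunit D a b" and "degree a = m" and "m > 1"
    and "qnorm D a b = [:k:]"
  shows
    "(\<forall>r. r > 0 \<and> even r \<and> Fract a b = Fract (cf_num (fls_sqrt D) r) (cf_den (fls_sqrt D) r) \<longrightarrow>
        (\<exists>l. l \<noteq> 0 \<and> smult l a = cf_num (fls_sqrt D) r \<and> smult l b = cf_den (fls_sqrt D) r \<and>
             qnorm D (cf_num (fls_sqrt D) r) (cf_den (fls_sqrt D) r) = 1)) \<and>
     (\<forall>c. k = c\<^sup>2 \<longrightarrow>
        \<not> irreducible D \<and>
        (\<exists>dp dm. b = dp * dm \<and>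
           dp\<^sup>2 dvd a + [:c:] \<and> dm\<^sup>2 dvd a - [:c:] \<and>
           D = ((a + [:c:]) div dp\<^sup>2) * ((a - [:c:]) div dm\<^sup>2) \<and>
           degree ((a + [:c:]) div dp\<^sup>2) > 0 \<and> degree ((a - [:c:]) div dm\<^sup>2) > 0)) \<and>
     (\<forall>c::complex. (\<nexists>q::rat. k = q\<^sup>2) \<and> of_rat k = c\<^sup>2 \<and> lead_coeff a = 1 \<and> lead_coeff b = 1 \<longrightarrow>
        (\<exists>d :: complex poly. set (coeffs d) \<subseteq> quad_field c \<and>
           map_poly of_rat b = d * poly_conj c d \<and>
           d\<^sup>2 dvd map_poly of_rat a + [:c:] \<and>
           (poly_conj c d)\<^sup>2 dvd map_poly of_rat a + [:quad_conj c c:] \<and>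
           set (coeffs ((map_poly of_rat a + [:c:]) div d\<^sup>2)) \<subseteq> quad_field c \<and>
           set (coeffs ((map_poly of_rat a + [:quad_conj c c:]) div (poly_conj c d)\<^sup>2))
             \<subseteq> quad_field c \<and>
           map_poly of_rat D =
             ((map_poly of_rat a + [:c:]) div d\<^sup>2) *
             ((map_poly of_rat a + [:quad_conj c c:]) div (poly_conj c d)\<^sup>2)))"
proof -
  have m: "degree a > 0" using assms(5,6) by simp
  have k0: "k \<noteq> 0"
    using assms(4,7) unfolding fundamental_qunit_def nontrivial_qunit_def qunit_def by auto
  have min: "\<And>a' b'. nontrivial_qunit D a' b' \<Longrightarrow> degree a \<le> degree a'"
    using assms(4) unfolding fundamental_qunit_def by blast
  have b0: "b \<noteq> 0"
  proof
    assume "b = 0"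
    then have "a\<^sup>2 = [:k:]" using assms(7) by (simp add: qnorm_def)
    then have "2 * degree a = 0" using m by (metis degree_pCons_0 degree_power_eq degree_0 less_irrefl)
    then show False using m by simp
  qed
  have a0: "a \<noteq> 0" using m by auto
  have D: "degree D = 2 * (g + 1)" using assms(3) by simp
  show ?thesis
  proof (intro conjI allI impI)
    fix r
    assume "r > 0 \<and> even r \<and> Fract a b = Fract (cf_num (fls_sqrt D) r) (cf_den (fls_sqrt D) r)"
    then show "\<exists>l. l \<noteq> 0 \<and> smult l a = cf_num (fls_sqrt D) r \<and> smult l b = cf_den (fls_sqrt D) r \<and>
             qnorm D (cf_num (fls_sqrt D) r) (cf_den (fls_sqrt D) r) = 1"
      using even_convergent_norm[OF assms(1,2) D _ assms(7) k0 a0 b0] by simp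
  next
    fix c assume k: "k = c\<^sup>2"
    note fac = square_norm_factorization[OF min m b0 _ assms(7)[unfolded k]]
    show ex: "\<exists>dp dm. b = dp * dm \<and>
           dp\<^sup>2 dvd a + [:c:] \<and> dm\<^sup>2 dvd a - [:c:] \<and>
           D = ((a + [:c:]) div dp\<^sup>2) * ((a - [:c:]) div dm\<^sup>2) \<and>
           degree ((a + [:c:]) div dp\<^sup>2) > 0 \<and> degree ((a - [:c:]) div dm\<^sup>2) > 0"
      using fac k k0 by auto
    show "\<not> irreducible D"
    proof
      assume irr: "irreducible D"
      obtain s t where "D = s * t" "degree s > 0" "degree t > 0" using ex by blast
      then show False using irreducibleD[OF irr, of s t] by (auto simp: is_unit_poly_iff)
    qed
  next
    fix c :: complex
    assume c: "(\<nexists>q::rat. k = q\<^sup>2) \<and> of_rat k = c\<^sup>2 \<and> lead_coeff a = 1 \<and> lead_coeff b = 1"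
    have "c \<notin> \<rat>"
    proof
      assume "c \<in> \<rat>"
      then obtain q where "c = of_rat q" by (auto elim: Rats_cases)
      then have "of_rat k = (of_rat (q\<^sup>2) :: complex)" using c by (simp add: of_rat_power)
      then show False using c of_rat_eq_iff by blast
    qed
    then show "\<exists>d :: complex poly. set (coeffs d) \<subseteq> quad_field c \<and>
           map_poly of_rat b = d * poly_conj c d \<and>
           d\<^sup>2 dvd map_poly of_rat a + [:c:] \<and>
           (poly_conj c d)\<^sup>2 dvd map_poly of_rat a + [:quad_conj c c:] \<and>
           set (coeffs ((map_poly of_rat a + [:c:]) div d\<^sup>2)) \<subseteq> quad_field c \<and>
           set (coeffs ((map_poly of_rat a + [:quad_conj c c:]) div (poly_conj c d)\<^sup>2))
             \<subseteq> quad_field c \<and>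
           map_poly of_rat D =
             ((map_poly of_rat a + [:c:]) div d\<^sup>2) *
             ((map_poly of_rat a + [:quad_conj c c:]) div (poly_conj c d)\<^sup>2)"
      using nonsquare_norm_factorization[OF b0 assms(7)] c by auto
  qed
qed

end
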